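(* Let $G$ be a group, $g\in G$, and let $(\mathcal B,\langle\!\langle-\rangle\!\rangle)$ be a shadowed bicategory equipped with $G$-twisting data. Let $M\in\mathcal B^{G\text{-tw}}(R,S)$ be a left dualizable 1-cell, with chosen left dual ${}^*M\in\mathcal B^{G\text{-tw}}(S,R)$. Let $Q,Q'\in\mathcal B^{G\text{-tw}}(S,S)$ and $P,P'\in\mathcal B^{G\text{-tw}}(R,R)$ be 1-cells, and let $f\colon M\odot Q\Rightarrow P\odot M$, $h\colon Q'\Rightarrow Q$, $k\colon P\Rightarrow P'$ be 2-cells in $\mathcal B^{G\text{-tw}}$. Then the $g$-twisted trace satisfies $${}^g\langle\!\langle k\rangle\!\rangle\circ\operatorname{tr}^g(f)\circ{}^g\langle\!\langle h\rangle\!\rangle=\operatorname{tr}^g\bigl((k\odot\mathrm{id}_M)\circ f\circ(\mathrm{id}_M\odot h)\bigr).$$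
   Context: **Bicategories.** For 1-cells $M\colon A\to B$, $N\colon B\to C$ the horizontal composite is written $M\odot N\colon A\to C$ (first $M$, then $N$); $U_A$ is the unit 1-cell; associators and unitors $\mathfrak a,\mathfrak l,\mathfrak r$ are suppressed where harmless. $\mathrm{Pic}_{\mathcal B}(A)$ is the monoidal groupoid (under $\odot$) of invertible 1-cells $A\to A$ and invertible 2-cells. **$G$-twisting data**: for each 0-cell $A$ a strong monoidal functor $\Theta_A\colon G\to\mathrm{Pic}_{\mathcal B}(A)$ with structure 2-cells $\mu^A_{g,h}\colon\Theta_A(g)\odot\Theta_A(h)\Rightarrow\Theta_A(gh)$, $\eta^A\colon U_A\Rightarrow\Theta_A(e)$. For $M\colon A\to B$: ${}^gM=\Theta_A(g^{-1})\odot M$, $M^g=M\odot\Theta_B(g)$; ${}^gf=\mathrm{id}\odot f$ for a 2-cell $f$. **Bicategory of $G$-twists $\mathcal B^{G\text{-tw}}$.** Same 0-cells. A 1-cell $A\to B$ is $(M,\tau)$ with $M\colon A\to B$ in $\mathcal B$ and invertible 2-cells $\tau_g\colon\Theta_A(g)\odot M\Rightarrow M\odot\Theta_B(g)$, $g\in G$, such that $\tau_e$ is the canonical isomorphism given by $\eta^A,\eta^B$ and unitors, and $\tau_{gh}=(\mathrm{id}_M\odot\mu^B_{g,h})(\tau_g\odot\mathrm{id})(\mathrm{id}\odot\tau_h)((\mu^A_{g,h})^{-1}\odot\mathrm{id}_M)$. A 2-cell $(M,\tau)\Rightarrow(N,\sigma)$ is a 2-cell $f\colon M\Rightarrow N$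 with $\sigma_g(\mathrm{id}\odot f)=(f\odot\mathrm{id})\tau_g$ for all $g$. Composite: $(M\odot N,\tau\star\sigma)$, $(\tau\star\sigma)_g=(\mathrm{id}_M\odot\sigma_g)(\tau_g\odot\mathrm{id}_N)$. Unit: $U_A$ with $\mathfrak l^{-1}\mathfrak r$. Transport map: $g_M=(\tau_{g^{-1}})^{-1}\colon M^{g^{-1}}\Rightarrow{}^gM$. **Shadows.** A shadow on $\mathcal B$ with values in a category $\mathcal T$ is a family of functors $\langle\!\langle-\rangle\!\rangle_R\colon\mathcal B(R,R)\to\mathcal T$ with natural isomorphisms $\theta_{M,N}\colon\langle\!\langle M\odot N\rangle\!\rangle_R\cong\langle\!\langle N\odot M\rangle\!\rangle_S$ ($M\colon R\to S$, $N\colon S\to R$) such that, up to associators, $\theta_{M\odot N,P}=\theta_{N,P\odot M}\circ\theta_{M,N\odot P}$, and $\langle\!\langle\mathfrak l\rangle\!\rangle\circ\theta_{M,U_R}=\langle\!\langle\mathfrak r\rangle\!\rangle$, $\langle\!\langle\mathfrak r\rangle\!\rangle\circ\theta_{U_R,M}=\langle\!\langle\mathfrak l\rangle\!\rangle$. **Twisted shadow.** ${}^g\langle\!\langle(M,\tau)\rangle\!\rangle_R=\langle\!\langle{}^gM\rangle\!\rangle_R$, ${}^g\langle\!\langle f\rangle\!\rangle=\langle\!\langle{}^gf\rangle\!\rangle$. Twisted cyclicity ${}^g\theta_{M,N}$: $\langle\!\langle\Theta_R(g^{-1})\odot M\odot N\rangle\!\rangle_R\xrightarrow{\theta}\langle\!\langle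 N\odot\Theta_R(g^{-1})\odot M\rangle\!\rangle_S\xrightarrow{g_N\odot\mathrm{id}}\langle\!\langle\Theta_S(g^{-1})\odot N\odot M\rangle\!\rangle_S$. **Twisted trace.** $M\colon R\to S$ is left dualizable with left dual ${}^*M\colon S\to R$ if there are 2-cells $\bar\eta\colon U_S\Rightarrow{}^*M\odot M$, $\bar\epsilon\colon M\odot{}^*M\Rightarrow U_R$ (in $\mathcal B^{G\text{-tw}}$) satisfying the triangle identities. For $Q\colon S\to S$, $P\colon R\to R$ and $f\colon M\odot Q\Rightarrow P\odot M$, $\operatorname{tr}^g(f)\colon{}^g\langle\!\langle Q\rangle\!\rangle_S\to{}^g\langle\!\langle P\rangle\!\rangle_R$ is ${}^g\langle\!\langle Q\rangle\!\rangle\xrightarrow{\bar\eta\odot\mathrm{id}}{}^g\langle\!\langle{}^*M\odot M\odot Q\rangle\!\rangle\xrightarrow{\mathrm{id}\odot f}{}^g\langle\!\langle{}^*M\odot P\odot M\rangle\!\rangle\xrightarrow{{}^g\theta_{{}^*M\odot P,M}}{}^g\langle\!\langle M\odot{}^*M\odot P\rangle\!\rangle\xrightarrow{\bar\epsilon\odot\mathrm{id}}{}^g\langle\!\langle P\rangle\!\rangle$. *)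

theory Defs
  imports "HOL-Algebra.Group"
begin

section \<open>Categories and functors\<close>

text \<open>
  Hom-sets are not required to be disjoint and the operations take no hom-set
  indices. A category in the usual sense is of this form, and in the twisted bicategory
  below a 2-cell can literally be a 2-cell of the underlying bicategory.
\<close>

record ('a, 'f) cat =
  Ob :: "'a set"
  Hom :: "'a \<Rightarrow> 'a \<Rightarrow> 'f set"
  Idn :: "'a \<Rightarrow> 'f"
  Cmp :: "'f \<Rightarrow> 'f \<Rightarrow> 'f" (infixr "\<cdot>\<index>" 55)

locale category =
  fixes C :: "('a, 'f) cat" (structure)
  assumes Idn_in: "X \<in> Ob C \<Longrightarrow> Idn C X \<in> Hom C X X"
    and Cmp_in: "\<lbrakk>X \<in> Ob C; Y \<in> Ob C; Z \<in> Ob C; f \<in> Hom C X Y; h \<in> Hom C Y Z\<rbrakk>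
      \<Longrightarrow> h \<cdot> f \<in> Hom C X Z"
    and Cmp_Idn: "\<lbrakk>X \<in> Ob C; Y \<in> Ob C; f \<in> Hom C X Y\<rbrakk> \<Longrightarrow> f \<cdot> Idn C X = f"
    and Idn_Cmp: "\<lbrakk>X \<in> Ob C; Y \<in> Ob C; f \<in> Hom C X Y\<rbrakk> \<Longrightarrow> Idn C Y \<cdot> f = f"
    and Cmp_assoc: "\<lbrakk>W \<in> Ob C; X \<in> Ob C; Y \<in> Ob C; Z \<in> Ob C;
        f \<in> Hom C W X; h \<in> Hom C X Y; k \<in> Hom C Y Z\<rbrakk>
      \<Longrightarrow> (k \<cdot> h) \<cdot> f = k \<cdot> (h \<cdot> f)"

definition is_inverse :: "('a, 'f) cat \<Rightarrow> 'a \<Rightarrow> 'a \<Rightarrow> 'f \<Rightarrow> 'f \<Rightarrow> bool" where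
  "is_inverse C X Y f h \<longleftrightarrow>
     h \<in> Hom C Y X \<and> h \<cdot>\<^bsub>C\<^esub> f = Idn C X \<and> f \<cdot>\<^bsub>C\<^esub> h = Idn C Y"

definition is_iso :: "('a, 'f) cat \<Rightarrow> 'a \<Rightarrow> 'a \<Rightarrow> 'f \<Rightarrow> bool" where
  "is_iso C X Y f \<longleftrightarrow> f \<in> Hom C X Y \<and> (\<exists>h. is_inverse C X Y f h)"

definition inv_mor :: "('a, 'f) cat \<Rightarrow> 'a \<Rightarrow> 'a \<Rightarrow> 'f \<Rightarrow> 'f" where
  "inv_mor C X Y f = (THE h. is_inverse C X Y f h)"

definition is_functor ::
  "('a, 'f) cat \<Rightarrow> ('b, 'h) cat \<Rightarrow> ('a \<Rightarrow> 'b) \<Rightarrow> ('f \<Rightarrow> 'h) \<Rightarrow> bool" where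
  "is_functor C D F0 F1 \<longleftrightarrow>
     (\<forall>X\<in>Ob C. F0 X \<in> Ob D) \<and>
     (\<forall>X\<in>Ob C. \<forall>Y\<in>Ob C. \<forall>f\<in>Hom C X Y. F1 f \<in> Hom D (F0 X) (F0 Y)) \<and>
     (\<forall>X\<in>Ob C. F1 (Idn C X) = Idn D (F0 X)) \<and>
     (\<forall>X\<in>Ob C. \<forall>Y\<in>Ob C. \<forall>Z\<in>Ob C. \<forall>f\<in>Hom C X Y. \<forall>h\<in>Hom C Y Z.
        F1 (h \<cdot>\<^bsub>C\<^esub> f) = F1 h \<cdot>\<^bsub>D\<^esub> F1 f)"


section \<open>Bicategories\<close>

text \<open>
  \<open>M \<odot> N\<close> is the diagrammatic composite (first \<open>M\<close>, then \<open>N\<close>), \<open>f \<star> h\<close> the horizontal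
  composite of 2-cells in the same order, and \<open>h \<bullet> f\<close> the vertical composite
  (first \<open>f\<close>, then \<open>h\<close>). The constraints are oriented as
  \<open>assoc M N P : (M \<odot> N) \<odot> P \<Rightarrow> M \<odot> (N \<odot> P)\<close>,
  \<open>lunit M : U A \<odot> M \<Rightarrow> M\<close> and \<open>runit M : M \<odot> U B \<Rightarrow> M\<close>.
\<close>

record ('o, 'm, 'c) bicat =
  Cell0 :: "'o set"
  Cell1 :: "'m set"
  src :: "'m \<Rightarrow> 'o"
  trg :: "'m \<Rightarrow> 'o"
  Cell2 :: "'m \<Rightarrow> 'm \<Rightarrow> 'c set"
  id2 :: "'m \<Rightarrow> 'c"
  vcomp :: "'c \<Rightarrow> 'c \<Rightarrow> 'c" (infixr "\<bullet>\<index>" 55)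
  unit1 :: "'o \<Rightarrow> 'm"
  comp1 :: "'m \<Rightarrow> 'm \<Rightarrow> 'm" (infixr "\<odot>\<index>" 75)
  hcomp :: "'c \<Rightarrow> 'c \<Rightarrow> 'c" (infixr "\<star>\<index>" 75)
  assoc :: "'m \<Rightarrow> 'm \<Rightarrow> 'm \<Rightarrow> 'c"
  lunit :: "'m \<Rightarrow> 'c"
  runit :: "'m \<Rightarrow> 'c"

definition hom1 :: "('o, 'm, 'c) bicat \<Rightarrow> 'o \<Rightarrow> 'o \<Rightarrow> 'm set" where
  "hom1 \<B> A B = {M \<in> Cell1 \<B>. src \<B> M = A \<and> trg \<B> M = B}"

definition hom_cat :: "('o, 'm, 'c) bicat \<Rightarrow> 'o \<Rightarrow> 'o \<Rightarrow> ('m, 'c) cat" where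
  "hom_cat \<B> A B = \<lparr>Ob = hom1 \<B> A B, Hom = Cell2 \<B>, Idn = id2 \<B>, Cmp = vcomp \<B>\<rparr>"

definition iso2 :: "('o, 'm, 'c) bicat \<Rightarrow> 'm \<Rightarrow> 'm \<Rightarrow> 'c \<Rightarrow> bool" where
  "iso2 \<B> M N f = is_iso (hom_cat \<B> (src \<B> M) (trg \<B> M)) M N f"

definition inv2 :: "('o, 'm, 'c) bicat \<Rightarrow> 'm \<Rightarrow> 'm \<Rightarrow> 'c \<Rightarrow> 'c" where
  "inv2 \<B> M N f = inv_mor (hom_cat \<B> (src \<B> M) (trg \<B> M)) M N f"

definition assoc_inv :: "('o, 'm, 'c) bicat \<Rightarrow> 'm \<Rightarrow> 'm \<Rightarrow> 'm \<Rightarrow> 'c" where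
  "assoc_inv \<B> M N P =
     inv2 \<B> ((M \<odot>\<^bsub>\<B>\<^esub> N) \<odot>\<^bsub>\<B>\<^esub> P) (M \<odot>\<^bsub>\<B>\<^esub> (N \<odot>\<^bsub>\<B>\<^esub> P)) (assoc \<B> M N P)"

definition lunit_inv :: "('o, 'm, 'c) bicat \<Rightarrow> 'm \<Rightarrow> 'c" where
  "lunit_inv \<B> M = inv2 \<B> (unit1 \<B> (src \<B> M) \<odot>\<^bsub>\<B>\<^esub> M) M (lunit \<B> M)"

definition runit_inv :: "('o, 'm, 'c) bicat \<Rightarrow> 'm \<Rightarrow> 'c" where
  "runit_inv \<B> M = inv2 \<B> (M \<odot>\<^bsub>\<B>\<^esub> unit1 \<B> (trg \<B> M)) M (runit \<B> M)"

locale bicategory =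
  fixes \<B> :: "('o, 'm, 'c) bicat" (structure)
  assumes src_in: "M \<in> Cell1 \<B> \<Longrightarrow> src \<B> M \<in> Cell0 \<B>"
    and trg_in: "M \<in> Cell1 \<B> \<Longrightarrow> trg \<B> M \<in> Cell0 \<B>"
    and hom_category: "\<lbrakk>A \<in> Cell0 \<B>; B \<in> Cell0 \<B>\<rbrakk> \<Longrightarrow> category (hom_cat \<B> A B)"
    and unit1_in: "A \<in> Cell0 \<B> \<Longrightarrow> unit1 \<B> A \<in> hom1 \<B> A A"
    and comp1_in: "\<lbrakk>M \<in> hom1 \<B> A B; N \<in> hom1 \<B> B C\<rbrakk> \<Longrightarrow> M \<odot> N \<in> hom1 \<B> A C"
    and hcomp_in: "\<lbrakk>M \<in> hom1 \<B> A B; M' \<in> hom1 \<B> A B; N \<in> hom1 \<B> B C; N' \<in> hom1 \<B> B C;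
        f \<in> Cell2 \<B> M M'; h \<in> Cell2 \<B> N N'\<rbrakk>
      \<Longrightarrow> f \<star> h \<in> Cell2 \<B> (M \<odot> N) (M' \<odot> N')"
    and hcomp_id: "\<lbrakk>M \<in> hom1 \<B> A B; N \<in> hom1 \<B> B C\<rbrakk>
      \<Longrightarrow> id2 \<B> M \<star> id2 \<B> N = id2 \<B> (M \<odot> N)"
    and interchange: "\<lbrakk>M \<in> hom1 \<B> A B; M' \<in> hom1 \<B> A B; M'' \<in> hom1 \<B> A B;
        N \<in> hom1 \<B> B C; N' \<in> hom1 \<B> B C; N'' \<in> hom1 \<B> B C;
        f \<in> Cell2 \<B> M M'; f' \<in> Cell2 \<B> M' M''; h \<in> Cell2 \<B> N N'; h' \<in> Cell2 \<B> N' N''\<rbrakk>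
      \<Longrightarrow> (f' \<bullet> f) \<star> (h' \<bullet> h) = (f' \<star> h') \<bullet> (f \<star> h)"
    and assoc_iso: "\<lbrakk>M \<in> hom1 \<B> A B; N \<in> hom1 \<B> B C; P \<in> hom1 \<B> C D\<rbrakk>
      \<Longrightarrow> iso2 \<B> ((M \<odot> N) \<odot> P) (M \<odot> (N \<odot> P)) (assoc \<B> M N P)"
    and assoc_natural: "\<lbrakk>M \<in> hom1 \<B> A B; M' \<in> hom1 \<B> A B; N \<in> hom1 \<B> B C; N' \<in> hom1 \<B> B C;
        P \<in> hom1 \<B> C D; P' \<in> hom1 \<B> C D;
        f \<in> Cell2 \<B> M M'; h \<in> Cell2 \<B> N N'; k \<in> Cell2 \<B> P P'\<rbrakk>
      \<Longrightarrow> assoc \<B> M' N' P' \<bullet> ((f \<star> h) \<star> k) = (f \<star> (h \<star> k)) \<bullet> assoc \<B> M N P"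
    and lunit_iso: "M \<in> hom1 \<B> A B \<Longrightarrow> iso2 \<B> (unit1 \<B> A \<odot> M) M (lunit \<B> M)"
    and lunit_natural: "\<lbrakk>M \<in> hom1 \<B> A B; M' \<in> hom1 \<B> A B; f \<in> Cell2 \<B> M M'\<rbrakk>
      \<Longrightarrow> lunit \<B> M' \<bullet> (id2 \<B> (unit1 \<B> A) \<star> f) = f \<bullet> lunit \<B> M"
    and runit_iso: "M \<in> hom1 \<B> A B \<Longrightarrow> iso2 \<B> (M \<odot> unit1 \<B> B) M (runit \<B> M)"
    and runit_natural: "\<lbrakk>M \<in> hom1 \<B> A B; M' \<in> hom1 \<B> A B; f \<in> Cell2 \<B> M M'\<rbrakk>
      \<Longrightarrow> runit \<B> M' \<bullet> (f \<star> id2 \<B> (unit1 \<B> B)) = f \<bullet> runit \<B> M"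
    and pentagon: "\<lbrakk>M \<in> hom1 \<B> A B; N \<in> hom1 \<B> B C; P \<in> hom1 \<B> C D; Q \<in> hom1 \<B> D E\<rbrakk>
      \<Longrightarrow> assoc \<B> M N (P \<odot> Q) \<bullet> assoc \<B> (M \<odot> N) P Q
        = (id2 \<B> M \<star> assoc \<B> N P Q) \<bullet> assoc \<B> M (N \<odot> P) Q \<bullet> (assoc \<B> M N P \<star> id2 \<B> Q)"
    and triangle: "\<lbrakk>M \<in> hom1 \<B> A B; N \<in> hom1 \<B> B C\<rbrakk>
      \<Longrightarrow> (id2 \<B> M \<star> lunit \<B> N) \<bullet> assoc \<B> M (unit1 \<B> B) N = runit \<B> M \<star> id2 \<B> N"

definition invertible1 :: "('o, 'm, 'c) bicat \<Rightarrow> 'o \<Rightarrow> 'o \<Rightarrow> 'm \<Rightarrow> bool" where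
  "invertible1 \<B> A B M \<longleftrightarrow> M \<in> hom1 \<B> A B \<and>
     (\<exists>N\<in>hom1 \<B> B A. (\<exists>u. iso2 \<B> (M \<odot>\<^bsub>\<B>\<^esub> N) (unit1 \<B> A) u) \<and>
                     (\<exists>v. iso2 \<B> (N \<odot>\<^bsub>\<B>\<^esub> M) (unit1 \<B> B) v))"

text \<open>\<open>N\<close> is a left dual of \<open>M : R \<rightarrow> S\<close>, with coevaluation \<open>c : U S \<Rightarrow> N \<odot> M\<close> and
  evaluation \<open>e : M \<odot> N \<Rightarrow> U R\<close>.\<close>

definition left_dual ::
  "('o, 'm, 'c) bicat \<Rightarrow> 'o \<Rightarrow> 'o \<Rightarrow> 'm \<Rightarrow> 'm \<Rightarrow> 'c \<Rightarrow> 'c \<Rightarrow> bool" where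
  "left_dual \<B> R S M N c e \<longleftrightarrow>
     M \<in> hom1 \<B> R S \<and> N \<in> hom1 \<B> S R \<and>
     c \<in> Cell2 \<B> (unit1 \<B> S) (N \<odot>\<^bsub>\<B>\<^esub> M) \<and>
     e \<in> Cell2 \<B> (M \<odot>\<^bsub>\<B>\<^esub> N) (unit1 \<B> R) \<and>
     lunit \<B> M \<bullet>\<^bsub>\<B>\<^esub> (e \<star>\<^bsub>\<B>\<^esub> id2 \<B> M) \<bullet>\<^bsub>\<B>\<^esub> assoc_inv \<B> M N M
       \<bullet>\<^bsub>\<B>\<^esub> (id2 \<B> M \<star>\<^bsub>\<B>\<^esub> c) \<bullet>\<^bsub>\<B>\<^esub> runit_inv \<B> M = id2 \<B> M \<and>
     runit \<B> N \<bullet>\<^bsub>\<B>\<^esub> (id2 \<B> N \<star>\<^bsub>\<B>\<^esub> e) \<bullet>\<^bsub>\<B>\<^esub> assoc \<B> N M N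
       \<bullet>\<^bsub>\<B>\<^esub> (c \<star>\<^bsub>\<B>\<^esub> id2 \<B> N) \<bullet>\<^bsub>\<B>\<^esub> lunit_inv \<B> N = id2 \<B> N"


section \<open>Shadows\<close>

record ('o, 'm, 'c, 'a, 'f) shadow_data =
  sh0 :: "'o \<Rightarrow> 'm \<Rightarrow> 'a"
  sh1 :: "'o \<Rightarrow> 'c \<Rightarrow> 'f"
  cyc :: "'m \<Rightarrow> 'm \<Rightarrow> 'f"

locale shadow = bicategory \<B> + category \<T>
  for \<B> :: "('o, 'm, 'c) bicat" (structure)
    and \<T> :: "('a, 'f) cat" (structure)
    and \<S> :: "('o, 'm, 'c, 'a, 'f) shadow_data" +
  assumes shadow_functor: "R \<in> Cell0 \<B> \<Longrightarrow> is_functor (hom_cat \<B> R R) \<T> (sh0 \<S> R) (sh1 \<S> R)"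
    and cyc_iso: "\<lbrakk>M \<in> hom1 \<B> R S; N \<in> hom1 \<B> S R\<rbrakk>
      \<Longrightarrow> is_iso \<T> (sh0 \<S> R (M \<odot>\<^bsub>\<B>\<^esub> N)) (sh0 \<S> S (N \<odot>\<^bsub>\<B>\<^esub> M)) (cyc \<S> M N)"
    and cyc_natural: "\<lbrakk>M \<in> hom1 \<B> R S; M' \<in> hom1 \<B> R S; N \<in> hom1 \<B> S R; N' \<in> hom1 \<B> S R;
        f \<in> Cell2 \<B> M M'; h \<in> Cell2 \<B> N N'\<rbrakk>
      \<Longrightarrow> cyc \<S> M' N' \<cdot>\<^bsub>\<T>\<^esub> sh1 \<S> R (f \<star>\<^bsub>\<B>\<^esub> h) = sh1 \<S> S (h \<star>\<^bsub>\<B>\<^esub> f) \<cdot>\<^bsub>\<T>\<^esub> cyc \<S> M N"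
    and cyc_comp: "\<lbrakk>M \<in> hom1 \<B> R S; N \<in> hom1 \<B> S T; P \<in> hom1 \<B> T R\<rbrakk>
      \<Longrightarrow> cyc \<S> (M \<odot>\<^bsub>\<B>\<^esub> N) P
        = sh1 \<S> T (assoc \<B> P M N) \<cdot>\<^bsub>\<T>\<^esub> cyc \<S> N (P \<odot>\<^bsub>\<B>\<^esub> M) \<cdot>\<^bsub>\<T>\<^esub> sh1 \<S> S (assoc \<B> N P M)
            \<cdot>\<^bsub>\<T>\<^esub> cyc \<S> M (N \<odot>\<^bsub>\<B>\<^esub> P) \<cdot>\<^bsub>\<T>\<^esub> sh1 \<S> R (assoc \<B> M N P)"
    and cyc_unit_right: "M \<in> hom1 \<B> R R
      \<Longrightarrow> sh1 \<S> R (lunit \<B> M) \<cdot>\<^bsub>\<T>\<^esub> cyc \<S> M (unit1 \<B> R) = sh1 \<S> R (runit \<B> M)"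
    and cyc_unit_left: "M \<in> hom1 \<B> R R
      \<Longrightarrow> sh1 \<S> R (runit \<B> M) \<cdot>\<^bsub>\<T>\<^esub> cyc \<S> (unit1 \<B> R) M = sh1 \<S> R (lunit \<B> M)"


section \<open>Twisting data and the bicategory of twists\<close>

record ('o, 'g, 'm, 'c) twisting =
  Tw :: "'o \<Rightarrow> 'g \<Rightarrow> 'm"
  mu :: "'o \<Rightarrow> 'g \<Rightarrow> 'g \<Rightarrow> 'c"
  eta :: "'o \<Rightarrow> 'c"

text \<open>
  For each 0-cell \<open>A\<close>, a strong monoidal functor from \<open>G\<close> to the monoidal groupoid of
  invertible 1-cells \<open>A \<rightarrow> A\<close> and invertible 2-cells. Since \<open>G\<close> is a discrete monoidal
  category, the functor is determined by its values on objects, and functoriality and the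
  naturality of \<open>mu\<close> hold automatically.
\<close>

locale twisting_data = bicategory \<B> + group G
  for G :: "('g, 'x) monoid_scheme" (structure)
    and \<B> :: "('o, 'm, 'c) bicat" (structure)
    and \<W> :: "('o, 'g, 'm, 'c) twisting" +
  assumes Tw_invertible: "\<lbrakk>A \<in> Cell0 \<B>; g \<in> carrier G\<rbrakk> \<Longrightarrow> invertible1 \<B> A A (Tw \<W> A g)"
    and mu_iso: "\<lbrakk>A \<in> Cell0 \<B>; g \<in> carrier G; h \<in> carrier G\<rbrakk>
      \<Longrightarrow> iso2 \<B> (Tw \<W> A g \<odot>\<^bsub>\<B>\<^esub> Tw \<W> A h) (Tw \<W> A (g \<otimes>\<^bsub>G\<^esub> h)) (mu \<W> A g h)"
    and eta_iso: "A \<in> Cell0 \<B> \<Longrightarrow> iso2 \<B> (unit1 \<B> A) (Tw \<W> A \<one>\<^bsub>G\<^esub>) (eta \<W> A)"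
    and mu_assoc: "\<lbrakk>A \<in> Cell0 \<B>; g \<in> carrier G; h \<in> carrier G; k \<in> carrier G\<rbrakk>
      \<Longrightarrow> mu \<W> A (g \<otimes>\<^bsub>G\<^esub> h) k \<bullet>\<^bsub>\<B>\<^esub> (mu \<W> A g h \<star>\<^bsub>\<B>\<^esub> id2 \<B> (Tw \<W> A k))
        = mu \<W> A g (h \<otimes>\<^bsub>G\<^esub> k) \<bullet>\<^bsub>\<B>\<^esub> (id2 \<B> (Tw \<W> A g) \<star>\<^bsub>\<B>\<^esub> mu \<W> A h k)
            \<bullet>\<^bsub>\<B>\<^esub> assoc \<B> (Tw \<W> A g) (Tw \<W> A h) (Tw \<W> A k)"
    and mu_unit_left: "\<lbrakk>A \<in> Cell0 \<B>; g \<in> carrier G\<rbrakk>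
      \<Longrightarrow> mu \<W> A \<one>\<^bsub>G\<^esub> g \<bullet>\<^bsub>\<B>\<^esub> (eta \<W> A \<star>\<^bsub>\<B>\<^esub> id2 \<B> (Tw \<W> A g)) = lunit \<B> (Tw \<W> A g)"
    and mu_unit_right: "\<lbrakk>A \<in> Cell0 \<B>; g \<in> carrier G\<rbrakk>
      \<Longrightarrow> mu \<W> A g \<one>\<^bsub>G\<^esub> \<bullet>\<^bsub>\<B>\<^esub> (id2 \<B> (Tw \<W> A g) \<star>\<^bsub>\<B>\<^esub> eta \<W> A) = runit \<B> (Tw \<W> A g)"

text \<open>
  A 1-cell of twists is a pair \<open>(M, \<tau>)\<close>; the family \<open>\<tau>\<close> is indexed by \<open>carrier G\<close>
  and extensional, so that it carries no information outside \<open>G\<close>. Below, \<open>A\<close> and \<open>B\<close> are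
  the source and target of \<open>M\<close>.
\<close>

definition twist_unit_cond ::
  "('g, 'x) monoid_scheme \<Rightarrow> ('o, 'm, 'c) bicat \<Rightarrow> ('o, 'g, 'm, 'c) twisting
     \<Rightarrow> 'm \<Rightarrow> ('g \<Rightarrow> 'c) \<Rightarrow> bool" where
  "twist_unit_cond G \<B> \<W> M \<tau> \<longleftrightarrow>
     (let A = src \<B> M; B = trg \<B> M in
      \<tau> \<one>\<^bsub>G\<^esub> =
        (id2 \<B> M \<star>\<^bsub>\<B>\<^esub> eta \<W> B)
        \<bullet>\<^bsub>\<B>\<^esub> runit_inv \<B> M
        \<bullet>\<^bsub>\<B>\<^esub> lunit \<B> M
        \<bullet>\<^bsub>\<B>\<^esub> (inv2 \<B> (unit1 \<B> A) (Tw \<W> A \<one>\<^bsub>G\<^esub>) (eta \<W> A) \<star>\<^bsub>\<B>\<^esub> id2 \<B> M))"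

definition twist_mult_cond ::
  "('g, 'x) monoid_scheme \<Rightarrow> ('o, 'm, 'c) bicat \<Rightarrow> ('o, 'g, 'm, 'c) twisting
     \<Rightarrow> 'm \<Rightarrow> ('g \<Rightarrow> 'c) \<Rightarrow> bool" where
  "twist_mult_cond G \<B> \<W> M \<tau> \<longleftrightarrow>
     (let A = src \<B> M; B = trg \<B> M in
      \<forall>g\<in>carrier G. \<forall>h\<in>carrier G.
        \<tau> (g \<otimes>\<^bsub>G\<^esub> h) =
          (id2 \<B> M \<star>\<^bsub>\<B>\<^esub> mu \<W> B g h)
          \<bullet>\<^bsub>\<B>\<^esub> assoc \<B> M (Tw \<W> B g) (Tw \<W> B h)
          \<bullet>\<^bsub>\<B>\<^esub> (\<tau> g \<star>\<^bsub>\<B>\<^esub> id2 \<B> (Tw \<W> B h))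
          \<bullet>\<^bsub>\<B>\<^esub> assoc_inv \<B> (Tw \<W> A g) M (Tw \<W> B h)
          \<bullet>\<^bsub>\<B>\<^esub> (id2 \<B> (Tw \<W> A g) \<star>\<^bsub>\<B>\<^esub> \<tau> h)
          \<bullet>\<^bsub>\<B>\<^esub> assoc \<B> (Tw \<W> A g) (Tw \<W> A h) M
          \<bullet>\<^bsub>\<B>\<^esub> (inv2 \<B> (Tw \<W> A g \<odot>\<^bsub>\<B>\<^esub> Tw \<W> A h) (Tw \<W> A (g \<otimes>\<^bsub>G\<^esub> h)) (mu \<W> A g h)
               \<star>\<^bsub>\<B>\<^esub> id2 \<B> M))"

definition twist_cells1 ::
  "('g, 'x) monoid_scheme \<Rightarrow> ('o, 'm, 'c) bicat \<Rightarrow> ('o, 'g, 'm, 'c) twisting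
     \<Rightarrow> ('m \<times> ('g \<Rightarrow> 'c)) set" where
  "twist_cells1 G \<B> \<W> = {(M, \<tau>). M \<in> Cell1 \<B> \<and> \<tau> \<in> extensional (carrier G) \<and>
     (\<forall>g\<in>carrier G. iso2 \<B> (Tw \<W> (src \<B> M) g \<odot>\<^bsub>\<B>\<^esub> M) (M \<odot>\<^bsub>\<B>\<^esub> Tw \<W> (trg \<B> M) g) (\<tau> g)) \<and>
     twist_unit_cond G \<B> \<W> M \<tau> \<and> twist_mult_cond G \<B> \<W> M \<tau>}"

definition twist_cells2 ::
  "('g, 'x) monoid_scheme \<Rightarrow> ('o, 'm, 'c) bicat \<Rightarrow> ('o, 'g, 'm, 'c) twisting
     \<Rightarrow> 'm \<times> ('g \<Rightarrow> 'c) \<Rightarrow> 'm \<times> ('g \<Rightarrow> 'c) \<Rightarrow> 'c set" where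
  "twist_cells2 G \<B> \<W> = (\<lambda>(M, \<tau>) (N, \<sigma>). {f \<in> Cell2 \<B> M N. \<forall>g\<in>carrier G.
     \<sigma> g \<bullet>\<^bsub>\<B>\<^esub> (id2 \<B> (Tw \<W> (src \<B> M) g) \<star>\<^bsub>\<B>\<^esub> f)
       = (f \<star>\<^bsub>\<B>\<^esub> id2 \<B> (Tw \<W> (trg \<B> M) g)) \<bullet>\<^bsub>\<B>\<^esub> \<tau> g})"

definition twist_comp1 ::
  "('g, 'x) monoid_scheme \<Rightarrow> ('o, 'm, 'c) bicat \<Rightarrow> ('o, 'g, 'm, 'c) twisting
     \<Rightarrow> 'm \<times> ('g \<Rightarrow> 'c) \<Rightarrow> 'm \<times> ('g \<Rightarrow> 'c) \<Rightarrow> 'm \<times> ('g \<Rightarrow> 'c)" where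
  "twist_comp1 G \<B> \<W> = (\<lambda>(M, \<tau>) (N, \<sigma>).
     let A = src \<B> M; B = trg \<B> M; C = trg \<B> N in
     (M \<odot>\<^bsub>\<B>\<^esub> N,
      \<lambda>g\<in>carrier G.
        assoc_inv \<B> M N (Tw \<W> C g)
        \<bullet>\<^bsub>\<B>\<^esub> (id2 \<B> M \<star>\<^bsub>\<B>\<^esub> \<sigma> g)
        \<bullet>\<^bsub>\<B>\<^esub> assoc \<B> M (Tw \<W> B g) N
        \<bullet>\<^bsub>\<B>\<^esub> (\<tau> g \<star>\<^bsub>\<B>\<^esub> id2 \<B> N)
        \<bullet>\<^bsub>\<B>\<^esub> assoc_inv \<B> (Tw \<W> A g) M N))"

definition twist_unit1 ::
  "('g, 'x) monoid_scheme \<Rightarrow> ('o, 'm, 'c) bicat \<Rightarrow> ('o, 'g, 'm, 'c) twisting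
     \<Rightarrow> 'o \<Rightarrow> 'm \<times> ('g \<Rightarrow> 'c)" where
  "twist_unit1 G \<B> \<W> A =
     (unit1 \<B> A, \<lambda>g\<in>carrier G. lunit_inv \<B> (Tw \<W> A g) \<bullet>\<^bsub>\<B>\<^esub> runit \<B> (Tw \<W> A g))"

definition twist_bicat ::
  "('g, 'x) monoid_scheme \<Rightarrow> ('o, 'm, 'c) bicat \<Rightarrow> ('o, 'g, 'm, 'c) twisting
     \<Rightarrow> ('o, 'm \<times> ('g \<Rightarrow> 'c), 'c) bicat" where
  "twist_bicat G \<B> \<W> = \<lparr>
     Cell0 = Cell0 \<B>,
     Cell1 = twist_cells1 G \<B> \<W>,
     src = (\<lambda>X. src \<B> (fst X)),
     trg = (\<lambda>X. trg \<B> (fst X)),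
     Cell2 = twist_cells2 G \<B> \<W>,
     id2 = (\<lambda>X. id2 \<B> (fst X)),
     vcomp = vcomp \<B>,
     unit1 = twist_unit1 G \<B> \<W>,
     comp1 = twist_comp1 G \<B> \<W>,
     hcomp = hcomp \<B>,
     assoc = (\<lambda>X Y Z. assoc \<B> (fst X) (fst Y) (fst Z)),
     lunit = (\<lambda>X. lunit \<B> (fst X)),
     runit = (\<lambda>X. runit \<B> (fst X))\<rparr>"


section \<open>Twisted shadow and twisted trace\<close>

definition ltwist1 ::
  "('g, 'x) monoid_scheme \<Rightarrow> ('o, 'm, 'c) bicat \<Rightarrow> ('o, 'g, 'm, 'c) twisting
     \<Rightarrow> 'g \<Rightarrow> 'o \<Rightarrow> 'm \<Rightarrow> 'm" where
  "ltwist1 G \<B> \<W> g A M = Tw \<W> A (inv\<^bsub>G\<^esub> g) \<odot>\<^bsub>\<B>\<^esub> M"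

definition ltwist2 ::
  "('g, 'x) monoid_scheme \<Rightarrow> ('o, 'm, 'c) bicat \<Rightarrow> ('o, 'g, 'm, 'c) twisting
     \<Rightarrow> 'g \<Rightarrow> 'o \<Rightarrow> 'c \<Rightarrow> 'c" where
  "ltwist2 G \<B> \<W> g A f = id2 \<B> (Tw \<W> A (inv\<^bsub>G\<^esub> g)) \<star>\<^bsub>\<B>\<^esub> f"

definition rtwist1 ::
  "('o, 'm, 'c) bicat \<Rightarrow> ('o, 'g, 'm, 'c) twisting \<Rightarrow> 'g \<Rightarrow> 'o \<Rightarrow> 'm \<Rightarrow> 'm" where
  "rtwist1 \<B> \<W> g B M = M \<odot>\<^bsub>\<B>\<^esub> Tw \<W> B g"

text \<open>The transport map of \<open>(M, \<tau>)\<close>, from \<open>M \<odot> Tw \<W> B (inv g)\<close> to \<open>Tw \<W> A (inv g) \<odot> M\<close>.\<close>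

definition transport ::
  "('g, 'x) monoid_scheme \<Rightarrow> ('o, 'm, 'c) bicat \<Rightarrow> ('o, 'g, 'm, 'c) twisting
     \<Rightarrow> 'g \<Rightarrow> 'm \<times> ('g \<Rightarrow> 'c) \<Rightarrow> 'c" where
  "transport G \<B> \<W> g = (\<lambda>(M, \<tau>).
     inv2 \<B> (ltwist1 G \<B> \<W> g (src \<B> M) M) (rtwist1 \<B> \<W> (inv\<^bsub>G\<^esub> g) (trg \<B> M) M)
       (\<tau> (inv\<^bsub>G\<^esub> g)))"

definition twisted_sh0 ::
  "('g, 'x) monoid_scheme \<Rightarrow> ('o, 'm, 'c) bicat \<Rightarrow> ('o, 'g, 'm, 'c) twisting
     \<Rightarrow> ('o, 'm, 'c, 'a, 'f) shadow_data \<Rightarrow> 'g \<Rightarrow> 'o \<Rightarrow> 'm \<times> ('g \<Rightarrow> 'c) \<Rightarrow> 'a" where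
  "twisted_sh0 G \<B> \<W> \<S> g R X = sh0 \<S> R (ltwist1 G \<B> \<W> g R (fst X))"

definition twisted_sh1 ::
  "('g, 'x) monoid_scheme \<Rightarrow> ('o, 'm, 'c) bicat \<Rightarrow> ('o, 'g, 'm, 'c) twisting
     \<Rightarrow> ('o, 'm, 'c, 'a, 'f) shadow_data \<Rightarrow> 'g \<Rightarrow> 'o \<Rightarrow> 'c \<Rightarrow> 'f" where
  "twisted_sh1 G \<B> \<W> \<S> g R f = sh1 \<S> R (ltwist2 G \<B> \<W> g R f)"

text \<open>For \<open>X = (M, \<tau>) : R \<rightarrow> S\<close> and \<open>Y = (N, \<sigma>) : S \<rightarrow> R\<close>; the associators that are
  suppressed in the informal composite are written out.\<close>

definition twisted_cyc ::
  "('g, 'x) monoid_scheme \<Rightarrow> ('o, 'm, 'c) bicat \<Rightarrow> ('a, 'f) cat \<Rightarrow> ('o, 'g, 'm, 'c) twisting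
     \<Rightarrow> ('o, 'm, 'c, 'a, 'f) shadow_data \<Rightarrow> 'g
     \<Rightarrow> 'm \<times> ('g \<Rightarrow> 'c) \<Rightarrow> 'm \<times> ('g \<Rightarrow> 'c) \<Rightarrow> 'f" where
  "twisted_cyc G \<B> \<T> \<W> \<S> g X Y =
     (let M = fst X; N = fst Y; R = src \<B> M; S = trg \<B> M;
          tR = Tw \<W> R (inv\<^bsub>G\<^esub> g); tS = Tw \<W> S (inv\<^bsub>G\<^esub> g) in
      sh1 \<S> S (assoc \<B> tS N M)
      \<cdot>\<^bsub>\<T>\<^esub> sh1 \<S> S (transport G \<B> \<W> g Y \<star>\<^bsub>\<B>\<^esub> id2 \<B> M)
      \<cdot>\<^bsub>\<T>\<^esub> sh1 \<S> S (assoc_inv \<B> N tR M)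
      \<cdot>\<^bsub>\<T>\<^esub> cyc \<S> (tR \<odot>\<^bsub>\<B>\<^esub> M) N
      \<cdot>\<^bsub>\<T>\<^esub> sh1 \<S> R (assoc_inv \<B> tR M N))"

text \<open>
  The trace of \<open>f : M \<odot> Q \<Rightarrow> P \<odot> M\<close> with respect to a left dual \<open>N\<close> of \<open>M\<close> with
  coevaluation \<open>c\<close> and evaluation \<open>e\<close>. The constraint cells of the bicategory of twists
  and their inverses are those of \<open>\<B>\<close>, and are taken there.
\<close>

definition twisted_trace ::
  "('g, 'x) monoid_scheme \<Rightarrow> ('o, 'm, 'c) bicat \<Rightarrow> ('a, 'f) cat \<Rightarrow> ('o, 'g, 'm, 'c) twisting
     \<Rightarrow> ('o, 'm, 'c, 'a, 'f) shadow_data \<Rightarrow> 'g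
     \<Rightarrow> 'm \<times> ('g \<Rightarrow> 'c) \<Rightarrow> 'm \<times> ('g \<Rightarrow> 'c) \<Rightarrow> 'c \<Rightarrow> 'c
     \<Rightarrow> 'm \<times> ('g \<Rightarrow> 'c) \<Rightarrow> 'm \<times> ('g \<Rightarrow> 'c) \<Rightarrow> 'c \<Rightarrow> 'f" where
  "twisted_trace G \<B> \<T> \<W> \<S> g M N c e Q P f =
     (let R = src \<B> (fst M); S = trg \<B> (fst M);
          M0 = fst M; N0 = fst N; Q0 = fst Q; P0 = fst P in
      twisted_sh1 G \<B> \<W> \<S> g R (lunit \<B> P0)
      \<cdot>\<^bsub>\<T>\<^esub> twisted_sh1 G \<B> \<W> \<S> g R (e \<star>\<^bsub>\<B>\<^esub> id2 \<B> P0)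
      \<cdot>\<^bsub>\<T>\<^esub> twisted_sh1 G \<B> \<W> \<S> g R (assoc_inv \<B> M0 N0 P0)
      \<cdot>\<^bsub>\<T>\<^esub> twisted_cyc G \<B> \<T> \<W> \<S> g (twist_comp1 G \<B> \<W> N P) M
      \<cdot>\<^bsub>\<T>\<^esub> twisted_sh1 G \<B> \<W> \<S> g S (assoc_inv \<B> N0 P0 M0)
      \<cdot>\<^bsub>\<T>\<^esub> twisted_sh1 G \<B> \<W> \<S> g S (id2 \<B> N0 \<star>\<^bsub>\<B>\<^esub> f)
      \<cdot>\<^bsub>\<T>\<^esub> twisted_sh1 G \<B> \<W> \<S> g S (assoc \<B> N0 M0 Q0)
      \<cdot>\<^bsub>\<T>\<^esub> twisted_sh1 G \<B> \<W> \<S> g S (c \<star>\<^bsub>\<B>\<^esub> id2 \<B> Q0)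
      \<cdot>\<^bsub>\<T>\<^esub> twisted_sh1 G \<B> \<W> \<S> g S (lunit_inv \<B> Q0))"

end

theory Submission
  imports Defs
begin

text \<open>
  The twisted trace of \<open>f\<close> is a vertical composite of nine cells, and each of them other
  than the image of \<open>f\<close> itself is a component of a natural transformation: in \<open>Q\<close>
  before \<open>f\<close> is applied, and in \<open>P\<close> afterwards. Hence the trace is natural in \<open>f\<close>, where
  a morphism from \<open>f : M \<odot> Q \<Rightarrow> P \<odot> M\<close> to \<open>f' : M \<odot> Q' \<Rightarrow> P' \<odot> M\<close> is a pair
  \<open>h : Q \<Rightarrow> Q'\<close>, \<open>k : P \<Rightarrow> P'\<close> such that
  \<open>(k \<star> id) \<bullet> f = f' \<bullet> (id \<star> h)\<close>. This is \<open>twisted_trace_square\<close>, obtained by pasting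
  nine naturality squares. Only the twisted cyclicity is not a formality: the group element is
  carried past \<open>M\<close> by the transport map of \<open>M\<close>, and \<open>M\<close> does not vary, so naturality in the
  other argument follows from that of \<open>cyc\<close> and from the interchange law
  (\<open>twisted_cyc_square\<close>).

  The theorem uses this twice. The pair \<open>(h, id)\<close> is a morphism from
  \<open>f \<bullet> (id \<star> h)\<close> to \<open>f\<close>, which moves \<open>h\<close> inside the trace; the pair \<open>(id, k)\<close> is a
  morphism from \<open>f \<bullet> (id \<star> h)\<close> to \<open>(k \<star> id) \<bullet> f \<bullet> (id \<star> h)\<close>, which moves \<open>k\<close> inside.
\<close>

section \<open>Commuting squares\<close>

text \<open>
  The typing of the sides is part of the predicate, because hom-sets may overlap: a morphism
  does not determine its source and target, and so pasting could not recover them. The square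
  is read as a morphism \<open>(a, a')\<close> from \<open>x\<close> to \<open>y\<close> in the arrow category.
\<close>

definition comm_square ::
  "('a, 'f) cat \<Rightarrow> 'a \<Rightarrow> 'a \<Rightarrow> 'a \<Rightarrow> 'a \<Rightarrow> 'f \<Rightarrow> 'f \<Rightarrow> 'f \<Rightarrow> 'f \<Rightarrow> bool" where
  "comm_square C X Y X' Y' a a' x y \<longleftrightarrow>
     X \<in> Ob C \<and> Y \<in> Ob C \<and> X' \<in> Ob C \<and> Y' \<in> Ob C \<and>
     a \<in> Hom C X Y \<and> a' \<in> Hom C X' Y' \<and> x \<in> Hom C X X' \<and> y \<in> Hom C Y Y' \<and>
     y \<cdot>\<^bsub>C\<^esub> a = a' \<cdot>\<^bsub>C\<^esub> x"

lemma comm_square_functor: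
  assumes "is_functor C D F0 F1" and "comm_square C X Y X' Y' a a' x y"
  shows "comm_square D (F0 X) (F0 Y) (F0 X') (F0 Y') (F1 a) (F1 a') (F1 x) (F1 y)"
proof -
  have "F1 (y \<cdot>\<^bsub>C\<^esub> a) = F1 y \<cdot>\<^bsub>D\<^esub> F1 a" "F1 (a' \<cdot>\<^bsub>C\<^esub> x) = F1 a' \<cdot>\<^bsub>D\<^esub> F1 x"
    using assms unfolding is_functor_def comm_square_def by blast+
  then show ?thesis
    using assms unfolding is_functor_def comm_square_def by auto
qed

lemma is_functor_comp:
  assumes "is_functor C D F0 F1" and "is_functor D E H0 H1"
  shows "is_functor C E (\<lambda>X. H0 (F0 X)) (\<lambda>f. H1 (F1 f))"
proof -
  have "H1 (F1 (h \<cdot>\<^bsub>C\<^esub> f)) = H1 (F1 h) \<cdot>\<^bsub>E\<^esub> H1 (F1 f)"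
    if ob: "X \<in> Ob C" "Y \<in> Ob C" "Z \<in> Ob C" and hom: "f \<in> Hom C X Y" "h \<in> Hom C Y Z"
    for X Y Z f h
  proof -
    have "F1 (h \<cdot>\<^bsub>C\<^esub> f) = F1 h \<cdot>\<^bsub>D\<^esub> F1 f"
      "F0 X \<in> Ob D" "F0 Y \<in> Ob D" "F0 Z \<in> Ob D"
      "F1 f \<in> Hom D (F0 X) (F0 Y)" "F1 h \<in> Hom D (F0 Y) (F0 Z)"
      using assms(1) that unfolding is_functor_def by blast+
    then show ?thesis using assms(2) unfolding is_functor_def by metis
  qed
  then show ?thesis using assms unfolding is_functor_def by simp
qed

context category
begin

lemma inverse_unique:
  assumes "X \<in> Ob C" "Y \<in> Ob C" "a \<in> Hom C X Y"
    and "is_inverse C X Y a b" "is_inverse C X Y a b'"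
  shows "b = b'"
proof -
  have "b = b \<cdot> (a \<cdot> b')" using assms Cmp_Idn by (simp add: is_inverse_def)
  also have "\<dots> = (b \<cdot> a) \<cdot> b'"
    using assms Cmp_assoc[of Y X Y X b' a b] by (simp add: is_inverse_def)
  also have "\<dots> = b'" using assms Idn_Cmp by (simp add: is_inverse_def)
  finally show ?thesis .
qed

lemma inv_mor_is_inverse:
  assumes "X \<in> Ob C" "Y \<in> Ob C" "is_iso C X Y a"
  shows "is_inverse C X Y a (inv_mor C X Y a)"
proof -
  have "a \<in> Hom C X Y" "\<exists>!b. is_inverse C X Y a b"
    using assms inverse_unique unfolding is_iso_def by blast+
  then show ?thesis unfolding inv_mor_def by (blast intro: theI')
qed

lemma comm_square_paste:
  assumes "comm_square C X Y X' Y' a a' x y" and "comm_square C Y Z Y' Z' b b' y z"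
  shows "comm_square C X Z X' Z' (b \<cdot> a) (b' \<cdot> a') x z"
proof -
  have "z \<cdot> (b \<cdot> a) = (z \<cdot> b) \<cdot> a"
    using assms Cmp_assoc[of X Y Z Z' a b z] by (simp add: comm_square_def)
  also have "\<dots> = (b' \<cdot> y) \<cdot> a" using assms by (simp add: comm_square_def)
  also have "\<dots> = b' \<cdot> (y \<cdot> a)"
    using assms Cmp_assoc[of X Y Y' Z' a y b'] by (simp add: comm_square_def)
  also have "\<dots> = b' \<cdot> (a' \<cdot> x)" using assms by (simp add: comm_square_def)
  also have "\<dots> = (b' \<cdot> a') \<cdot> x"
    using assms Cmp_assoc[of X X' Y' Z' x a' b'] by (simp add: comm_square_def)
  finally show ?thesis using assms Cmp_in unfolding comm_square_def by blast
qed

text \<open>The components of the inverse of a natural isomorphism are again natural.\<close>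

lemma comm_square_inv:
  assumes sq: "comm_square C X Y X' Y' a a' x y"
    and iso: "is_iso C X Y a" "is_iso C X' Y' a'"
  shows "comm_square C Y X Y' X' (inv_mor C X Y a) (inv_mor C X' Y' a') y x"
proof -
  let ?b = "inv_mor C X Y a" and ?b' = "inv_mor C X' Y' a'"
  have ob: "X \<in> Ob C" "Y \<in> Ob C" "X' \<in> Ob C" "Y' \<in> Ob C"
    and hom: "a \<in> Hom C X Y" "a' \<in> Hom C X' Y'" "x \<in> Hom C X X'" "y \<in> Hom C Y Y'"
    and eq: "y \<cdot> a = a' \<cdot> x"
    using sq by (auto simp: comm_square_def)
  have b: "?b \<in> Hom C Y X" "a \<cdot> ?b = Idn C Y"
    and b': "?b' \<in> Hom C Y' X'" "?b' \<cdot> a' = Idn C X'"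
    using inv_mor_is_inverse iso ob unfolding is_inverse_def by auto
  have xb: "x \<cdot> ?b \<in> Hom C Y X'" using Cmp_in ob hom b by blast
  have "x \<cdot> ?b = (?b' \<cdot> a') \<cdot> (x \<cdot> ?b)" using Idn_Cmp ob xb b' by simp
  also have "\<dots> = ?b' \<cdot> (a' \<cdot> (x \<cdot> ?b))" using Cmp_assoc ob hom xb b' by blast
  also have "a' \<cdot> (x \<cdot> ?b) = (a' \<cdot> x) \<cdot> ?b"
    using Cmp_assoc[of Y X X' Y' ?b x a'] ob hom b by simp
  also have "\<dots> = y \<cdot> (a \<cdot> ?b)"
    using Cmp_assoc[of Y X Y Y' ?b a y] ob hom b eq by simp
  also have "\<dots> = y" using Cmp_Idn ob hom b by simp
  finally show ?thesis using ob hom b b' unfolding comm_square_def by blast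
qed

end


section \<open>Naturality squares in a bicategory\<close>

lemma hom_cat_simps [simp]:
  "Ob (hom_cat \<B> A B) = hom1 \<B> A B"
  "Hom (hom_cat \<B> A B) = Cell2 \<B>"
  "Idn (hom_cat \<B> A B) = id2 \<B>"
  "Cmp (hom_cat \<B> A B) = vcomp \<B>"
  by (simp_all add: hom_cat_def)

context bicategory
begin

lemma hom1_ends:
  assumes "M \<in> hom1 \<B> A B"
  shows "src \<B> M = A" "trg \<B> M = B" "A \<in> Cell0 \<B>" "B \<in> Cell0 \<B>"
  using assms src_in trg_in by (auto simp: hom1_def)

lemma hom_cat_category: "M \<in> hom1 \<B> A B \<Longrightarrow> category (hom_cat \<B> A B)"
  using hom_category hom1_ends by blast

lemma id2_in: "M \<in> hom1 \<B> A B \<Longrightarrow> id2 \<B> M \<in> Cell2 \<B> M M"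
  using category.Idn_in[OF hom_cat_category] by simp

lemma vcomp_id: "\<lbrakk>M \<in> hom1 \<B> A B; N \<in> hom1 \<B> A B; f \<in> Cell2 \<B> M N\<rbrakk> \<Longrightarrow> f \<bullet> id2 \<B> M = f"
  using category.Cmp_Idn[OF hom_cat_category] by simp

lemma id_vcomp: "\<lbrakk>M \<in> hom1 \<B> A B; N \<in> hom1 \<B> A B; f \<in> Cell2 \<B> M N\<rbrakk> \<Longrightarrow> id2 \<B> N \<bullet> f = f"
  using category.Idn_Cmp[OF hom_cat_category] by simp

lemma vcomp_in:
  "\<lbrakk>M \<in> hom1 \<B> A B; N \<in> hom1 \<B> A B; P \<in> hom1 \<B> A B; f \<in> Cell2 \<B> M N; h \<in> Cell2 \<B> N P\<rbrakk>
    \<Longrightarrow> h \<bullet> f \<in> Cell2 \<B> M P"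
  using category.Cmp_in[OF hom_cat_category] by simp

lemma iso2_hom_cat:
  "M \<in> hom1 \<B> A B \<Longrightarrow> iso2 \<B> M N f \<longleftrightarrow> is_iso (hom_cat \<B> A B) M N f"
  by (simp add: iso2_def hom1_ends)

lemma inv2_hom_cat:
  "M \<in> hom1 \<B> A B \<Longrightarrow> inv2 \<B> M N f = inv_mor (hom_cat \<B> A B) M N f"
  by (simp add: inv2_def hom1_ends)

lemma inv2_in:
  assumes "M \<in> hom1 \<B> A B" "N \<in> hom1 \<B> A B" "iso2 \<B> M N f"
  shows "inv2 \<B> M N f \<in> Cell2 \<B> N M"
  using category.inv_mor_is_inverse[OF hom_cat_category[OF assms(1)], of M N f] assms
  by (simp add: iso2_hom_cat inv2_hom_cat is_inverse_def)

lemma left_whisker_functor: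
  assumes "L \<in> hom1 \<B> A B" "C \<in> Cell0 \<B>"
  shows "is_functor (hom_cat \<B> B C) (hom_cat \<B> A C) (\<lambda>M. L \<odot> M) (\<lambda>f. id2 \<B> L \<star> f)"
proof -
  have "id2 \<B> L \<star> (h \<bullet> f) = (id2 \<B> L \<star> h) \<bullet> (id2 \<B> L \<star> f)"
    if "X \<in> hom1 \<B> B C" "Y \<in> hom1 \<B> B C" "Z \<in> hom1 \<B> B C"
      "f \<in> Cell2 \<B> X Y" "h \<in> Cell2 \<B> Y Z" for X Y Z f h
    using interchange[OF assms(1) assms(1) assms(1) that(1-3) id2_in[OF assms(1)]
        id2_in[OF assms(1)] that(4,5)] vcomp_id[OF assms(1) assms(1) id2_in[OF assms(1)]]
    by simp
  then show ?thesis
    using assms comp1_in hcomp_in id2_in hcomp_id unfolding is_functor_def by auto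
qed

text \<open>The two ways of writing \<open>b \<star> f\<close> as a composite of whiskered cells.\<close>

lemma whisker_square:
  assumes K: "K \<in> hom1 \<B> A B" "K' \<in> hom1 \<B> A B" "b \<in> Cell2 \<B> K K'"
    and M: "M \<in> hom1 \<B> B C" "M' \<in> hom1 \<B> B C" "f \<in> Cell2 \<B> M M'"
  shows "comm_square (hom_cat \<B> A C) (K \<odot> M) (K' \<odot> M) (K \<odot> M') (K' \<odot> M')
    (b \<star> id2 \<B> M) (b \<star> id2 \<B> M') (id2 \<B> K \<star> f) (id2 \<B> K' \<star> f)"
proof -
  note ids = id2_in[OF K(1)] id2_in[OF K(2)] id2_in[OF M(1)] id2_in[OF M(2)]
  have "(id2 \<B> K' \<star> f) \<bullet> (b \<star> id2 \<B> M) = b \<star> f"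
    using interchange[OF K(1,2,2) M(1,1,2) K(3) ids(2) ids(3) M(3)]
      id_vcomp[OF K] vcomp_id[OF M] by simp
  also have "\<dots> = (b \<star> id2 \<B> M') \<bullet> (id2 \<B> K \<star> f)"
    using interchange[OF K(1,1,2) M(1,2,2) ids(1) K(3) M(3) ids(4)]
      vcomp_id[OF K] id_vcomp[OF M] by simp
  finally show ?thesis
    using K M ids comp1_in hcomp_in by (simp add: comm_square_def)
qed

lemma lunit_square:
  assumes "M \<in> hom1 \<B> A B" "M' \<in> hom1 \<B> A B" "f \<in> Cell2 \<B> M M'"
  shows "comm_square (hom_cat \<B> A B) (unit1 \<B> A \<odot> M) M (unit1 \<B> A \<odot> M') M'
    (lunit \<B> M) (lunit \<B> M') (id2 \<B> (unit1 \<B> A) \<star> f) f"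
proof -
  have U: "unit1 \<B> A \<in> hom1 \<B> A A" using unit1_in hom1_ends assms(1) by blast
  note UM = comp1_in[OF U assms(1)] comp1_in[OF U assms(2)]
  have "lunit \<B> M \<in> Cell2 \<B> (unit1 \<B> A \<odot> M) M" "lunit \<B> M' \<in> Cell2 \<B> (unit1 \<B> A \<odot> M') M'"
    using lunit_iso[OF assms(1)] lunit_iso[OF assms(2)] UM
    by (simp_all add: iso2_hom_cat is_iso_def)
  then show ?thesis
    using assms UM lunit_natural[OF assms] hcomp_in[OF U U assms(1,2) id2_in[OF U] assms(3)]
    by (simp add: comm_square_def)
qed

lemma lunit_inv_square:
  assumes "M \<in> hom1 \<B> A B" "M' \<in> hom1 \<B> A B" "f \<in> Cell2 \<B> M M'"
  shows "comm_square (hom_cat \<B> A B) M (unit1 \<B> A \<odot> M) M' (unit1 \<B> A \<odot> M')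
    (lunit_inv \<B> M) (lunit_inv \<B> M') f (id2 \<B> (unit1 \<B> A) \<star> f)"
proof -
  have U: "unit1 \<B> A \<in> hom1 \<B> A A" using unit1_in hom1_ends assms(1) by blast
  note UM = comp1_in[OF U assms(1)] comp1_in[OF U assms(2)]
  show ?thesis
    using category.comm_square_inv[OF hom_cat_category[OF assms(1)] lunit_square[OF assms]]
      lunit_iso[OF assms(1)] lunit_iso[OF assms(2)] UM assms
    by (simp add: iso2_hom_cat inv2_hom_cat lunit_inv_def hom1_ends)
qed

lemma assoc_square:
  assumes M: "M \<in> hom1 \<B> A B" "M' \<in> hom1 \<B> A B" "f \<in> Cell2 \<B> M M'"
    and N: "N \<in> hom1 \<B> B C" "N' \<in> hom1 \<B> B C" "h \<in> Cell2 \<B> N N'"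
    and P: "P \<in> hom1 \<B> C D" "P' \<in> hom1 \<B> C D" "k \<in> Cell2 \<B> P P'"
  shows "comm_square (hom_cat \<B> A D)
    ((M \<odot> N) \<odot> P) (M \<odot> (N \<odot> P)) ((M' \<odot> N') \<odot> P') (M' \<odot> (N' \<odot> P'))
    (assoc \<B> M N P) (assoc \<B> M' N' P') ((f \<star> h) \<star> k) (f \<star> (h \<star> k))"
proof -
  note MN = comp1_in[OF M(1) N(1)] comp1_in[OF M(2) N(2)]
  note NP = comp1_in[OF N(1) P(1)] comp1_in[OF N(2) P(2)]
  note MNP = comp1_in[OF MN(1) P(1)] comp1_in[OF MN(2) P(2)]
    comp1_in[OF M(1) NP(1)] comp1_in[OF M(2) NP(2)]
  have "assoc \<B> M N P \<in> Cell2 \<B> ((M \<odot> N) \<odot> P) (M \<odot> (N \<odot> P))"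
    "assoc \<B> M' N' P' \<in> Cell2 \<B> ((M' \<odot> N') \<odot> P') (M' \<odot> (N' \<odot> P'))"
    using assoc_iso[OF M(1) N(1) P(1)] assoc_iso[OF M(2) N(2) P(2)] MNP
    by (simp_all add: iso2_hom_cat is_iso_def)
  moreover have "(f \<star> h) \<star> k \<in> Cell2 \<B> ((M \<odot> N) \<odot> P) ((M' \<odot> N') \<odot> P')"
    using hcomp_in[OF MN P(1,2) hcomp_in[OF M(1,2) N(1,2) M(3) N(3)] P(3)] .
  moreover have "f \<star> (h \<star> k) \<in> Cell2 \<B> (M \<odot> (N \<odot> P)) (M' \<odot> (N' \<odot> P'))"
    using hcomp_in[OF M(1,2) NP M(3) hcomp_in[OF N(1,2) P(1,2) N(3) P(3)]] .
  ultimately show ?thesis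
    using MNP assoc_natural[OF M(1,2) N(1,2) P(1,2) M(3) N(3) P(3)]
    by (simp add: comm_square_def)
qed

lemma assoc_inv_square:
  assumes M: "M \<in> hom1 \<B> A B" "M' \<in> hom1 \<B> A B" "f \<in> Cell2 \<B> M M'"
    and N: "N \<in> hom1 \<B> B C" "N' \<in> hom1 \<B> B C" "h \<in> Cell2 \<B> N N'"
    and P: "P \<in> hom1 \<B> C D" "P' \<in> hom1 \<B> C D" "k \<in> Cell2 \<B> P P'"
  shows "comm_square (hom_cat \<B> A D)
    (M \<odot> (N \<odot> P)) ((M \<odot> N) \<odot> P) (M' \<odot> (N' \<odot> P')) ((M' \<odot> N') \<odot> P')
    (assoc_inv \<B> M N P) (assoc_inv \<B> M' N' P') (f \<star> (h \<star> k)) ((f \<star> h) \<star> k)"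
proof -
  have MNP: "(M \<odot> N) \<odot> P \<in> hom1 \<B> A D" "(M' \<odot> N') \<odot> P' \<in> hom1 \<B> A D"
    using M N P comp1_in by blast+
  show ?thesis
    using category.comm_square_inv[OF hom_cat_category[OF MNP(1)] assoc_square[OF M N P]]
      assoc_iso[OF M(1) N(1) P(1)] assoc_iso[OF M(2) N(2) P(2)] MNP
    by (simp add: iso2_hom_cat inv2_hom_cat assoc_inv_def)
qed

end


section \<open>Naturality of the twisted cyclicity and of the twisted trace\<close>

locale twisted_shadow = shadow \<B> \<T> \<S> + twisting_data G \<B> \<W>
  for G :: "('g, 'x) monoid_scheme"
    and \<B> :: "('o, 'm, 'c) bicat"
    and \<T> :: "('a, 'f) cat"
    and \<S> :: "('o, 'm, 'c, 'a, 'f) shadow_data"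
    and \<W> :: "('o, 'g, 'm, 'c) twisting"
begin

lemma Tw_in: "\<lbrakk>A \<in> Cell0 \<B>; g \<in> carrier G\<rbrakk> \<Longrightarrow> Tw \<W> A g \<in> hom1 \<B> A A"
  using Tw_invertible by (simp add: invertible1_def)

lemma twisted_shadow_functor:
  assumes "R \<in> Cell0 \<B>" "g \<in> carrier G"
  shows "is_functor (hom_cat \<B> R R) \<T>
    (\<lambda>M. sh0 \<S> R (ltwist1 G \<B> \<W> g R M)) (twisted_sh1 G \<B> \<W> \<S> g R)"
proof -
  have "twisted_sh1 G \<B> \<W> \<S> g R
      = (\<lambda>f. sh1 \<S> R (id2 \<B> (Tw \<W> R (inv\<^bsub>G\<^esub> g)) \<star>\<^bsub>\<B>\<^esub> f))"
    by (simp add: fun_eq_iff twisted_sh1_def ltwist2_def)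
  moreover have "Tw \<W> R (inv\<^bsub>G\<^esub> g) \<in> hom1 \<B> R R" using Tw_in assms inv_closed by blast
  ultimately show ?thesis
    using is_functor_comp[OF left_whisker_functor shadow_functor] assms(1)
    by (simp add: ltwist1_def)
qed

lemma transport_in:
  assumes "M \<in> twist_cells1 G \<B> \<W>" "fst M \<in> hom1 \<B> R S" "g \<in> carrier G"
  shows "transport G \<B> \<W> g M \<in> Cell2 \<B>
    (fst M \<odot>\<^bsub>\<B>\<^esub> Tw \<W> S (inv\<^bsub>G\<^esub> g)) (Tw \<W> R (inv\<^bsub>G\<^esub> g) \<odot>\<^bsub>\<B>\<^esub> fst M)"
proof -
  have "inv\<^bsub>G\<^esub> g \<in> carrier G" using assms(3) by simp
  moreover have "Tw \<W> R (inv\<^bsub>G\<^esub> g) \<odot>\<^bsub>\<B>\<^esub> fst M \<in> hom1 \<B> R S"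
      "fst M \<odot>\<^bsub>\<B>\<^esub> Tw \<W> S (inv\<^bsub>G\<^esub> g) \<in> hom1 \<B> R S"
    using comp1_in Tw_in assms(2) hom1_ends[OF assms(2)] calculation by blast+
  ultimately show ?thesis
    using assms inv2_in hom1_ends[OF assms(2)]
    by (auto simp: twist_cells1_def transport_def ltwist1_def rtwist1_def split: prod.splits)
qed

lemma cyc_square:
  assumes M: "M \<in> hom1 \<B> R S" "M' \<in> hom1 \<B> R S" "f \<in> Cell2 \<B> M M'"
    and N: "N \<in> hom1 \<B> S R" "N' \<in> hom1 \<B> S R" "h \<in> Cell2 \<B> N N'"
  shows "comm_square \<T>
    (sh0 \<S> R (M \<odot>\<^bsub>\<B>\<^esub> N)) (sh0 \<S> S (N \<odot>\<^bsub>\<B>\<^esub> M)) (sh0 \<S> R (M' \<odot>\<^bsub>\<B>\<^esub> N')) (sh0 \<S> S (N' \<odot>\<^bsub>\<B>\<^esub> M'))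
    (cyc \<S> M N) (cyc \<S> M' N') (sh1 \<S> R (f \<star>\<^bsub>\<B>\<^esub> h)) (sh1 \<S> S (h \<star>\<^bsub>\<B>\<^esub> f))"
proof -
  note ends = hom1_ends(3,4)[OF M(1)]
  note comp = comp1_in[OF M(1) N(1)] comp1_in[OF M(2) N(2)]
    comp1_in[OF N(1) M(1)] comp1_in[OF N(2) M(2)]
  show ?thesis
    using comp shadow_functor[OF ends(1)] shadow_functor[OF ends(2)]
      hcomp_in[OF M(1,2) N(1,2) M(3) N(3)] hcomp_in[OF N(1,2) M(1,2) N(3) M(3)]
      cyc_natural[OF M(1,2) N(1,2) M(3) N(3)]
      cyc_iso[OF M(1) N(1)] cyc_iso[OF M(2) N(2)]
    unfolding comm_square_def is_functor_def is_iso_def by simp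
qed

text \<open>
  The five squares follow the five factors of the twisted cyclicity. The identity whiskered
  onto \<open>x\<close> changes from that of \<open>M \<odot> Tw S\<close> to that of \<open>Tw R \<odot> M\<close> at the transport map,
  which acts on the other tensor factor and so commutes with \<open>x\<close> by interchange.
\<close>

lemma twisted_cyc_square:
  assumes g: "g \<in> carrier G"
    and X: "fst X \<in> hom1 \<B> S R" "fst X' \<in> hom1 \<B> S R" "x \<in> Cell2 \<B> (fst X) (fst X')"
    and M: "M \<in> twist_cells1 G \<B> \<W>" "fst M \<in> hom1 \<B> R S"
  shows "comm_square \<T>
    (sh0 \<S> S (ltwist1 G \<B> \<W> g S (fst X \<odot>\<^bsub>\<B>\<^esub> fst M)))
    (sh0 \<S> R (ltwist1 G \<B> \<W> g R (fst M \<odot>\<^bsub>\<B>\<^esub> fst X)))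
    (sh0 \<S> S (ltwist1 G \<B> \<W> g S (fst X' \<odot>\<^bsub>\<B>\<^esub> fst M)))
    (sh0 \<S> R (ltwist1 G \<B> \<W> g R (fst M \<odot>\<^bsub>\<B>\<^esub> fst X')))
    (twisted_cyc G \<B> \<T> \<W> \<S> g X M) (twisted_cyc G \<B> \<T> \<W> \<S> g X' M)
    (twisted_sh1 G \<B> \<W> \<S> g S (x \<star>\<^bsub>\<B>\<^esub> id2 \<B> (fst M)))
    (twisted_sh1 G \<B> \<W> \<S> g R (id2 \<B> (fst M) \<star>\<^bsub>\<B>\<^esub> x))"
proof -
  let ?M = "fst M" and ?tR = "Tw \<W> R (inv\<^bsub>G\<^esub> g)" and ?tS = "Tw \<W> S (inv\<^bsub>G\<^esub> g)"
  note RS = hom1_ends(3,4)[OF M(2)]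
  have t: "?tR \<in> hom1 \<B> R R" "?tS \<in> hom1 \<B> S S" using Tw_in RS g by simp_all
  note idR = id2_in[OF t(1)] and idS = id2_in[OF t(2)] and idM = id2_in[OF M(2)]
  note tX = comp1_in[OF t(2) X(1)] comp1_in[OF t(2) X(2)]
    hcomp_in[OF t(2) t(2) X(1,2) idS X(3)]
  note Mt = comp1_in[OF M(2) t(2)] comp1_in[OF t(1) M(2)] transport_in[OF M g]
  note FR = comm_square_functor[OF shadow_functor[OF RS(1)]]
    and FS = comm_square_functor[OF shadow_functor[OF RS(2)]]
  note s1 = FS[OF assoc_inv_square[OF t(2) t(2) idS X M(2) M(2) idM]]
  note s2 = cyc_square[OF tX M(2) M(2) idM]
  \<comment> \<open>\<open>id M \<star> id tS\<close> is rewritten to \<open>id (M \<odot> tS)\<close> so that this side matches that of \<open>s4\<close>.\<close>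
  note s3 = FR[OF assoc_inv_square[OF M(2) M(2) idM t(2) t(2) idS X],
      unfolded hcomp_id[OF M(2) t(2)]]
  note s4 = FR[OF whisker_square[OF Mt X]]
  note s5 = FR[OF assoc_square[OF t(1) t(1) idR M(2) M(2) idM X], unfolded hcomp_id[OF t(1) M(2)]]
  show ?thesis
    using comm_square_paste[OF comm_square_paste[OF comm_square_paste[OF
          comm_square_paste[OF s1 s2] s3] s4] s5] X(1,2)
    by (simp add: twisted_cyc_def Let_def hom1_ends ltwist1_def twisted_sh1_def ltwist2_def)
qed

text \<open>
  The cells before \<open>f\<close> are natural in \<open>Q\<close> (\<open>s1\<close> to \<open>s3\<close> below), those after it in \<open>P\<close>
  (\<open>s5\<close> to \<open>s9\<close>); the hypothesis on \<open>f\<close> and \<open>f'\<close> is the square in the middle (\<open>s4\<close>), and so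
  is what lets the two families be pasted.
\<close>

lemma twisted_trace_square:
  assumes g: "g \<in> carrier G"
    and M: "M \<in> twist_cells1 G \<B> \<W>" "fst M \<in> hom1 \<B> R S" and N: "fst N \<in> hom1 \<B> S R"
    and c: "c \<in> Cell2 \<B> (unit1 \<B> S) (fst N \<odot>\<^bsub>\<B>\<^esub> fst M)"
    and e: "e \<in> Cell2 \<B> (fst M \<odot>\<^bsub>\<B>\<^esub> fst N) (unit1 \<B> R)"
    and Q: "fst Q \<in> hom1 \<B> S S" "fst Q' \<in> hom1 \<B> S S" "h \<in> Cell2 \<B> (fst Q) (fst Q')"
    and P: "fst P \<in> hom1 \<B> R R" "fst P' \<in> hom1 \<B> R R" "k \<in> Cell2 \<B> (fst P) (fst P')"
    and f: "f \<in> Cell2 \<B> (fst M \<odot>\<^bsub>\<B>\<^esub> fst Q) (fst P \<odot>\<^bsub>\<B>\<^esub> fst M)"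
      "f' \<in> Cell2 \<B> (fst M \<odot>\<^bsub>\<B>\<^esub> fst Q') (fst P' \<odot>\<^bsub>\<B>\<^esub> fst M)"
    and eq: "(k \<star>\<^bsub>\<B>\<^esub> id2 \<B> (fst M)) \<bullet>\<^bsub>\<B>\<^esub> f = f' \<bullet>\<^bsub>\<B>\<^esub> (id2 \<B> (fst M) \<star>\<^bsub>\<B>\<^esub> h)"
  shows "comm_square \<T>
    (sh0 \<S> S (ltwist1 G \<B> \<W> g S (fst Q))) (sh0 \<S> R (ltwist1 G \<B> \<W> g R (fst P)))
    (sh0 \<S> S (ltwist1 G \<B> \<W> g S (fst Q'))) (sh0 \<S> R (ltwist1 G \<B> \<W> g R (fst P')))
    (twisted_trace G \<B> \<T> \<W> \<S> g M N c e Q P f) (twisted_trace G \<B> \<T> \<W> \<S> g M N c e Q' P' f')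
    (twisted_sh1 G \<B> \<W> \<S> g S h) (twisted_sh1 G \<B> \<W> \<S> g R k)"
proof -
  let ?M = "fst M" and ?N = "fst N"
  note RS = hom1_ends(3,4)[OF M(2)]
  note idM = id2_in[OF M(2)] and idN = id2_in[OF N]
  note MN = comp1_in[OF M(2) N] and NM = comp1_in[OF N M(2)]
  note FR = comm_square_functor[OF twisted_shadow_functor[OF RS(1) g]]
    and FS = comm_square_functor[OF twisted_shadow_functor[OF RS(2) g]]
  note s1 = FS[OF lunit_inv_square[OF Q]]
  note s2 = FS[OF whisker_square[OF unit1_in[OF RS(2)] NM c Q]]
  note s3 = FS[OF assoc_square[OF N N idN M(2) M(2) idM Q], unfolded hcomp_id[OF N M(2)]]
  have "comm_square (hom_cat \<B> R S) (?M \<odot>\<^bsub>\<B>\<^esub> fst Q) (fst P \<odot>\<^bsub>\<B>\<^esub> ?M)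
      (?M \<odot>\<^bsub>\<B>\<^esub> fst Q') (fst P' \<odot>\<^bsub>\<B>\<^esub> ?M) f f'
      (id2 \<B> ?M \<star>\<^bsub>\<B>\<^esub> h) (k \<star>\<^bsub>\<B>\<^esub> id2 \<B> ?M)"
    using comp1_in[OF M(2) Q(1)] comp1_in[OF M(2) Q(2)] comp1_in[OF P(1) M(2)]
      comp1_in[OF P(2) M(2)] hcomp_in[OF M(2) M(2) Q(1,2) idM Q(3)]
      hcomp_in[OF P(1,2) M(2) M(2) P(3) idM] f eq
    by (simp add: comm_square_def)
  note s4 = FS[OF comm_square_functor[OF left_whisker_functor[OF N RS(2)] this]]
  note s5 = FS[OF assoc_inv_square[OF N N idN P M(2) M(2) idM]]
  have NP: "fst (twist_comp1 G \<B> \<W> N P) = ?N \<odot>\<^bsub>\<B>\<^esub> fst P"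
    "fst (twist_comp1 G \<B> \<W> N P') = ?N \<odot>\<^bsub>\<B>\<^esub> fst P'"
    by (simp_all add: twist_comp1_def Let_def split: prod.splits)
  have s6: "comm_square \<T>
    (sh0 \<S> S (ltwist1 G \<B> \<W> g S ((?N \<odot>\<^bsub>\<B>\<^esub> fst P) \<odot>\<^bsub>\<B>\<^esub> ?M)))
    (sh0 \<S> R (ltwist1 G \<B> \<W> g R (?M \<odot>\<^bsub>\<B>\<^esub> (?N \<odot>\<^bsub>\<B>\<^esub> fst P))))
    (sh0 \<S> S (ltwist1 G \<B> \<W> g S ((?N \<odot>\<^bsub>\<B>\<^esub> fst P') \<odot>\<^bsub>\<B>\<^esub> ?M)))
    (sh0 \<S> R (ltwist1 G \<B> \<W> g R (?M \<odot>\<^bsub>\<B>\<^esub> (?N \<odot>\<^bsub>\<B>\<^esub> fst P'))))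
    (twisted_cyc G \<B> \<T> \<W> \<S> g (twist_comp1 G \<B> \<W> N P) M)
    (twisted_cyc G \<B> \<T> \<W> \<S> g (twist_comp1 G \<B> \<W> N P') M)
    (twisted_sh1 G \<B> \<W> \<S> g S ((id2 \<B> ?N \<star>\<^bsub>\<B>\<^esub> k) \<star>\<^bsub>\<B>\<^esub> id2 \<B> ?M))
    (twisted_sh1 G \<B> \<W> \<S> g R (id2 \<B> ?M \<star>\<^bsub>\<B>\<^esub> (id2 \<B> ?N \<star>\<^bsub>\<B>\<^esub> k)))"
    using twisted_cyc_square[OF g _ _ _ M, of "twist_comp1 G \<B> \<W> N P" "twist_comp1 G \<B> \<W> N P'"]
      comp1_in[OF N P(1)] comp1_in[OF N P(2)] hcomp_in[OF N N P(1,2) idN P(3)]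
    by (simp add: NP)
  note s7 = FR[OF assoc_inv_square[OF M(2) M(2) idM N N idN P], unfolded hcomp_id[OF M(2) N]]
  note s8 = FR[OF whisker_square[OF MN unit1_in[OF RS(1)] e P]]
  note s9 = FR[OF lunit_square[OF P]]
  note s14 = comm_square_paste[OF comm_square_paste[OF comm_square_paste[OF s1 s2] s3] s4]
  show ?thesis
    using comm_square_paste[OF comm_square_paste[OF comm_square_paste[OF
          comm_square_paste[OF comm_square_paste[OF s14 s5] s6] s7] s8] s9]
    by (simp add: twisted_trace_def Let_def hom1_ends[OF M(2)])
qed

end


section \<open>Tightening\<close>

lemma twist_bicat_hom1:
  assumes "X \<in> hom1 (twist_bicat G \<B> \<W>) A B"
  shows "X \<in> twist_cells1 G \<B> \<W>" "fst X \<in> hom1 \<B> A B"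
  using assms by (auto simp: hom1_def twist_bicat_def twist_cells1_def)

lemma twist_bicat_Cell2:
  "f \<in> Cell2 (twist_bicat G \<B> \<W>) X Y \<Longrightarrow> f \<in> Cell2 \<B> (fst X) (fst Y)"
  by (auto simp: twist_bicat_def twist_cells2_def split: prod.splits)

lemma twist_bicat_simps:
  "fst (comp1 (twist_bicat G \<B> \<W>) X Y) = fst X \<odot>\<^bsub>\<B>\<^esub> fst Y"
  "fst (unit1 (twist_bicat G \<B> \<W>) A) = unit1 \<B> A"
  "id2 (twist_bicat G \<B> \<W>) X = id2 \<B> (fst X)"
  "vcomp (twist_bicat G \<B> \<W>) = vcomp \<B>"
  "hcomp (twist_bicat G \<B> \<W>) = hcomp \<B>"
  by (simp_all add: twist_bicat_def twist_comp1_def twist_unit1_def Let_def split: prod.splits)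

theorem proposition6p1:
  fixes G :: "('g, 'x) monoid_scheme"
    and \<B> :: "('o, 'm, 'c) bicat"
    and \<T> :: "('a, 'f) cat"
    and \<S> :: "('o, 'm, 'c, 'a, 'f) shadow_data"
    and \<W> :: "('o, 'g, 'm, 'c) twisting"
    and \<E> :: "('o, 'm \<times> ('g \<Rightarrow> 'c), 'c) bicat"
    and R S :: 'o
    and M N Q Q' P P' :: "'m \<times> ('g \<Rightarrow> 'c)"
    and c e f h k :: 'c
  assumes "group G" and "g \<in> carrier G"
    and "shadow \<B> \<T> \<S>"
    and "twisting_data G \<B> \<W>"
    and "\<E> = twist_bicat G \<B> \<W>"
    and "R \<in> Cell0 \<B>" and "S \<in> Cell0 \<B>"
    and "left_dual \<E> R S M N c e"
    and "Q \<in> hom1 \<E> S S" and "Q' \<in> hom1 \<E> S S"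
    and "P \<in> hom1 \<E> R R" and "P' \<in> hom1 \<E> R R"
    and "f \<in> Cell2 \<E> (M \<odot>\<^bsub>\<E>\<^esub> Q) (P \<odot>\<^bsub>\<E>\<^esub> M)"
    and "h \<in> Cell2 \<E> Q' Q"
    and "k \<in> Cell2 \<E> P P'"
  shows "twisted_sh1 G \<B> \<W> \<S> g R k
           \<cdot>\<^bsub>\<T>\<^esub> twisted_trace G \<B> \<T> \<W> \<S> g M N c e Q P f
           \<cdot>\<^bsub>\<T>\<^esub> twisted_sh1 G \<B> \<W> \<S> g S h
         = twisted_trace G \<B> \<T> \<W> \<S> g M N c e Q' P'
             ((k \<star>\<^bsub>\<E>\<^esub> id2 \<E> M) \<bullet>\<^bsub>\<E>\<^esub> f \<bullet>\<^bsub>\<E>\<^esub> (id2 \<E> M \<star>\<^bsub>\<E>\<^esub> h))"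
proof -
  interpret twisted_shadow G \<B> \<T> \<S> \<W>
    using assms(3,4) by (rule twisted_shadow.intro)
  note E = assms(5)
  let ?M = "fst M"
  have dual: "M \<in> hom1 \<E> R S" "N \<in> hom1 \<E> S R"
    "c \<in> Cell2 \<E> (unit1 \<E> S) (N \<odot>\<^bsub>\<E>\<^esub> M)" "e \<in> Cell2 \<E> (M \<odot>\<^bsub>\<E>\<^esub> N) (unit1 \<E> R)"
    using assms(8) by (simp_all add: left_dual_def)
  note M = twist_bicat_hom1[OF dual(1)[unfolded E]] and N = twist_bicat_hom1(2)[OF dual(2)[unfolded E]]
  note c = twist_bicat_Cell2[OF dual(3)[unfolded E], unfolded twist_bicat_simps]
    and e = twist_bicat_Cell2[OF dual(4)[unfolded E], unfolded twist_bicat_simps]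
  note Q = assms(9)[unfolded E, THEN twist_bicat_hom1(2)]
    and Q' = assms(10)[unfolded E, THEN twist_bicat_hom1(2)]
    and P = assms(11)[unfolded E, THEN twist_bicat_hom1(2)]
    and P' = assms(12)[unfolded E, THEN twist_bicat_hom1(2)]
    and f = assms(13)[unfolded E, THEN twist_bicat_Cell2, unfolded twist_bicat_simps]
    and h = assms(14)[unfolded E, THEN twist_bicat_Cell2]
    and k = assms(15)[unfolded E, THEN twist_bicat_Cell2]
  note comps = comp1_in[OF M(2) Q'] comp1_in[OF M(2) Q] comp1_in[OF P M(2)] comp1_in[OF P' M(2)]
  note Mh = hcomp_in[OF M(2) M(2) Q' Q id2_in[OF M(2)] h]
    and kM = hcomp_in[OF P P' M(2) M(2) k id2_in[OF M(2)]]
  let ?f = "f \<bullet>\<^bsub>\<B>\<^esub> (id2 \<B> ?M \<star>\<^bsub>\<B>\<^esub> h)"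
  let ?F = "(k \<star>\<^bsub>\<B>\<^esub> id2 \<B> ?M) \<bullet>\<^bsub>\<B>\<^esub> ?f"
  have f': "?f \<in> Cell2 \<B> (?M \<odot>\<^bsub>\<B>\<^esub> fst Q') (fst P \<odot>\<^bsub>\<B>\<^esub> ?M)"
    using vcomp_in[OF comps(1-3) Mh f] .
  have F: "?F \<in> Cell2 \<B> (?M \<odot>\<^bsub>\<B>\<^esub> fst Q') (fst P' \<odot>\<^bsub>\<B>\<^esub> ?M)"
    using vcomp_in[OF comps(1,3,4) f' kM] .
  let ?sR = "twisted_sh1 G \<B> \<W> \<S> g R" and ?sS = "twisted_sh1 G \<B> \<W> \<S> g S"
  let ?tr = "twisted_trace G \<B> \<T> \<W> \<S> g M N c e"
  have id_shadow: "?sR (id2 \<B> (fst P)) = Idn \<T> (sh0 \<S> R (ltwist1 G \<B> \<W> g R (fst P)))"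
    "?sS (id2 \<B> (fst Q')) = Idn \<T> (sh0 \<S> S (ltwist1 G \<B> \<W> g S (fst Q')))"
    using twisted_shadow_functor[OF assms(6,2)] twisted_shadow_functor[OF assms(7,2)] P Q'
    by (simp_all add: is_functor_def)
  have "(id2 \<B> (fst P) \<star>\<^bsub>\<B>\<^esub> id2 \<B> ?M) \<bullet>\<^bsub>\<B>\<^esub> ?f = ?f"
    using hcomp_id[OF P M(2)] id_vcomp[OF comps(1,3) f'] by simp
  note sq_h = twisted_trace_square[OF assms(2) M N c e Q' Q h P P id2_in[OF P] f' f this]
  have "?F = ?F \<bullet>\<^bsub>\<B>\<^esub> (id2 \<B> ?M \<star>\<^bsub>\<B>\<^esub> id2 \<B> (fst Q'))"
    using hcomp_id[OF M(2) Q'] vcomp_id[OF comps(1,4) F] by simp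
  note sq_k = twisted_trace_square[OF assms(2) M N c e Q' Q' id2_in[OF Q'] P P' k f' F this]
  \<comment> \<open>In each square one vertical side is the image of an identity, and the square is a triangle.\<close>
  have "?tr Q P f \<cdot>\<^bsub>\<T>\<^esub> ?sS h = ?tr Q' P ?f"
    using sq_h Idn_Cmp unfolding comm_square_def id_shadow by metis
  moreover have "?sR k \<cdot>\<^bsub>\<T>\<^esub> ?tr Q' P ?f = ?tr Q' P' ?F"
    using sq_k Cmp_Idn unfolding comm_square_def id_shadow by metis
  ultimately show ?thesis unfolding E twist_bicat_simps by simp
qed

end
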